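(* Let $r\in\mathbb{C}$ be nonzero and not of the form $-1/m$ with $m$ a positive integer, and let $b_0,b_1,b_2,s_1,s_2\in\mathbb{C}$. Then, as rational functions of $n$, $$R(\alpha(n,r))=\alpha(n,r),$$ $$R(\beta(n,r))=\beta(n-1,r),$$ $$\alpha(n,r)=\frac{-r^2\,\gamma(n,1,r)\,R(\gamma(n,1,r))}{(2nr-r+1)(2nr-3r+1)}.$$
   Context: Put $x_k=b_0+b_1k+b_2k(k-1)$ (a polynomial in $k$) and $$\gamma(n,m,r)=\frac{(n-m+1)\bigl((nr-mr+1)x_{n-m}+(n-m)s_2+s_1\bigr)}{(2n-m-1)r+1},$$ $$\beta(n,r)=x_n-\bigl(\gamma(n+1,1,r)-\gamma(n,1,r)\bigr),$$ $$\alpha(n,r)=\gamma(n,1,r)\Bigl(\tfrac12\bigl(\gamma(n,0,r)-2\gamma(n,1,r)+\gamma(n,2,r)\bigr)-(x_n-x_{n-1})\Bigr),$$ regarded as rational functions of $n$. For $r\neq0$, $R$ is the involution on rational functions $w(n)$ of $n$ given by $R(w(n))=w\bigl(-n+2-\tfrac1r\bigr)$. *)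

theory Defs
  imports "HOL-Computational_Algebra.Computational_Algebra" "HOL-Computational_Algebra.Field_as_Ring"
begin

type_synonym ratfun = "complex poly fract"

definition rconst :: "complex \<Rightarrow> ratfun" where
  "rconst c = to_fract [:c:]"

definition rvar :: ratfun where
  "rvar = to_fract [:0, 1:]"

text \<open>
  In the following definitions the parameters are complex constants, while the argument \<open>n\<close>
  is an element of the field of rational functions. The rational function
  \<open>\<gamma>(n,1,r)\<close> is obtained at \<open>n = rvar\<close>, and for instance \<open>\<gamma>(n+1,1,r)\<close> at \<open>rvar + 1\<close>.
\<close>

definition xpoly :: "complex \<Rightarrow> complex \<Rightarrow> complex \<Rightarrow> ratfun \<Rightarrow> ratfun" where
  "xpoly b0 b1 b2 k = rconst b0 + rconst b1 * k + rconst b2 * k * (k - 1)"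

definition gamma ::
    "complex \<Rightarrow> complex \<Rightarrow> complex \<Rightarrow> complex \<Rightarrow> complex \<Rightarrow> ratfun \<Rightarrow> nat \<Rightarrow> complex \<Rightarrow> ratfun" where
  "gamma b0 b1 b2 s1 s2 n m r =
     (n - of_nat m + 1) *
       ((n * rconst r - of_nat m * rconst r + 1) * xpoly b0 b1 b2 (n - of_nat m)
         + (n - of_nat m) * rconst s2 + rconst s1)
     / ((2 * n - of_nat m - 1) * rconst r + 1)"

definition beta ::
    "complex \<Rightarrow> complex \<Rightarrow> complex \<Rightarrow> complex \<Rightarrow> complex \<Rightarrow> ratfun \<Rightarrow> complex \<Rightarrow> ratfun" where
  "beta b0 b1 b2 s1 s2 n r =
     xpoly b0 b1 b2 n - (gamma b0 b1 b2 s1 s2 (n + 1) 1 r - gamma b0 b1 b2 s1 s2 n 1 r)"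

definition alpha ::
    "complex \<Rightarrow> complex \<Rightarrow> complex \<Rightarrow> complex \<Rightarrow> complex \<Rightarrow> ratfun \<Rightarrow> complex \<Rightarrow> ratfun" where
  "alpha b0 b1 b2 s1 s2 n r =
     gamma b0 b1 b2 s1 s2 n 1 r *
       (1 / 2 * (gamma b0 b1 b2 s1 s2 n 0 r - 2 * gamma b0 b1 b2 s1 s2 n 1 r
                  + gamma b0 b1 b2 s1 s2 n 2 r)
        - (xpoly b0 b1 b2 n - xpoly b0 b1 b2 (n - 1)))"

text \<open>
  Substitution of a polynomial \<open>L\<close> for the variable of a rational function; it is meaningful
  only for non-constant \<open>L\<close>, where it does not depend on the representing fraction.
\<close>

definition ratfun_subst :: "ratfun \<Rightarrow> complex poly \<Rightarrow> ratfun" where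
  "ratfun_subst w L =
     (let (p, q) = quot_of_fract w in Fraction_Field.Fract (p \<circ>\<^sub>p L) (q \<circ>\<^sub>p L))"

definition R_inv :: "complex \<Rightarrow> ratfun \<Rightarrow> ratfun" where
  "R_inv r w = ratfun_subst w [:2 - 1 / r, -1:]"

lemma ratfun_subst_Fract:
  assumes "q \<noteq> 0" "degree L > 0"
  shows "ratfun_subst (Fraction_Field.Fract p q) L = Fraction_Field.Fract (p \<circ>\<^sub>p L) (q \<circ>\<^sub>p L)"
proof -
  obtain a b where ab: "quot_of_fract (Fraction_Field.Fract p q) = (a, b)"
    by force
  have b: "b \<noteq> 0"
    using snd_quot_of_fract_nonzero[of "Fraction_Field.Fract p q"] ab by simp
  have "Fraction_Field.Fract a b = Fraction_Field.Fract p q"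
    using quot_to_fract_quot_of_fract[of "Fraction_Field.Fract p q"] ab
    by (simp add: quot_to_fract_def)
  hence "a * q = p * b"
    using b assms by (simp add: eq_fract)
  hence "(a \<circ>\<^sub>p L) * (q \<circ>\<^sub>p L) = (p \<circ>\<^sub>p L) * (b \<circ>\<^sub>p L)"
    by (metis pcompose_mult)
  moreover have "b \<circ>\<^sub>p L \<noteq> 0" "q \<circ>\<^sub>p L \<noteq> 0"
    using b assms pcompose_eq_0 by blast+
  ultimately show ?thesis
    by (simp add: ratfun_subst_def ab eq_fract)
qed

lemma R_inv_rvar: "R_inv r rvar = - rvar + 2 - 1 / rconst r"
proof -
  have "1 / rconst r = rconst (1 / r)"
  proof (cases "r = 0")
    case False
    hence "rconst r * rconst (1 / r) = 1" "rconst r \<noteq> 0"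
      unfolding rconst_def by (simp_all flip: to_fract_mult add: one_pCons[symmetric])
    thus ?thesis by (simp add: field_simps)
  qed (simp add: rconst_def)
  moreover have "to_fract [:2 - 1 / r, -1:] = - rvar + rconst 2 - rconst (1 / r)"
    unfolding rvar_def rconst_def by (simp flip: to_fract_diff to_fract_uminus to_fract_add)
  moreover have "rconst 2 = 2"
  proof -
    have "rconst 2 = rconst 1 + rconst 1"
      unfolding rconst_def by (simp flip: to_fract_add)
    thus ?thesis by (simp add: rconst_def one_pCons[symmetric])
  qed
  moreover have "R_inv r rvar = to_fract [:2 - 1 / r, -1:]"
    by (simp add: R_inv_def rvar_def to_fract_def ratfun_subst_Fract pcompose_pCons pcompose_1)
  ultimately show ?thesis by simp
qed

lemma R_inv_R_inv: "R_inv r (R_inv r w) = w"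
proof (cases w)
  case (Fract p q)
  let ?L = "[:2 - 1 / r, -1:]"
  have "q \<circ>\<^sub>p ?L \<noteq> 0"
    using Fract pcompose_eq_0[of q ?L] by auto
  moreover have "s \<circ>\<^sub>p ?L \<circ>\<^sub>p ?L = s" for s :: "complex poly"
    by (simp flip: pcompose_assoc add: pcompose_pCons)
  ultimately show ?thesis
    using Fract by (simp add: R_inv_def ratfun_subst_Fract)
qed

end

(* With i = 1/r one has gamma(n,m) = P(n+1-m) / (2n-m-1+i) for a polynomial P, and
   R maps n to 2-i-n, so it changes the sign of t = 2n-2+i. Clearing denominators reduces the
   product formula for alpha and the formula for beta to polynomial identities in n and i.
   The product formula is visibly symmetric under R, which gives the invariance of alpha. *)
theory Submission
  imports Defs
begin

section \<open>Constants and linear polynomials inside the field of rational functions\<close>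

lemma rconst_eq_0_iff [simp]: "rconst c = 0 \<longleftrightarrow> c = 0"
  by (simp add: rconst_def)

lemma rconst_of_nat: "rconst (of_nat n) = of_nat n"
proof (induction n)
  case (Suc n)
  have "rconst (of_nat (Suc n)) = rconst 1 + rconst (of_nat n)"
    by (simp add: rconst_def flip: to_fract_add)
  thus ?case
    by (simp add: Suc.IH) (simp add: rconst_def one_pCons[symmetric])
qed (simp add: rconst_def)

lemma rconst_numeral: "rconst (numeral k) = numeral k"
  using rconst_of_nat[of "numeral k"] by simp

lemma two_ratfun_nonzero: "(2 :: ratfun) \<noteq> 0"
  using rconst_numeral[of "num.Bit0 num.One"] rconst_eq_0_iff[of 2] by simp

text \<open>This is the image of a polynomial of degree 1. Every denominator to be cleared later has
  this shape.\<close>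

lemma two_rvar_add_nonzero: "2 * rvar + rconst c \<noteq> 0"
proof -
  have "2 * rvar + rconst c = rconst 2 * rvar + rconst c"
    by (simp add: rconst_numeral)
  also have "\<dots> = to_fract [:c, 2:]"
    by (simp add: rconst_def rvar_def flip: to_fract_mult to_fract_add)
  finally show ?thesis
    by simp
qed

lemma rconst_diff: "rconst (a - b) = rconst a - rconst b"
  by (simp add: rconst_def flip: to_fract_diff)

lemma rconst_add: "rconst (a + b) = rconst a + rconst b"
  by (simp add: rconst_def flip: to_fract_add)

lemma rconst_inverse: "rconst (1 / r) = 1 / rconst r"
proof (cases "r = 0")
  case False
  hence "rconst (1 / r) * rconst r = 1"
    by (simp add: rconst_def flip: to_fract_mult one_pCons)
  thus ?thesis
    using False by (simp add: nonzero_eq_divide_eq)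
qed (simp add: rconst_def)

section \<open>The substitution \<open>R_inv\<close> as a field automorphism fixing the
  constants\<close>

lemma ratfun_cases:
  obtains p q where "w = Fraction_Field.Fract p q" "q \<noteq> (0 :: complex poly)"
  by (cases w) auto

text \<open>Composition with a nonconstant polynomial kills no nonzero polynomial, so denominators
  stay nonzero under the substitution.\<close>

lemma pcompose_nonconst_nonzero:
  fixes q :: "complex poly"
  assumes "q \<noteq> 0"
  shows "q \<circ>\<^sub>p [:a, -1:] \<noteq> 0"
  using assms pcompose_eq_0[of q "[:a, -1:]"] by auto

lemma R_inv_Fract:
  "q \<noteq> 0 \<Longrightarrow> R_inv r (Fraction_Field.Fract p q) =
     Fraction_Field.Fract (p \<circ>\<^sub>p [:2 - 1 / r, -1:]) (q \<circ>\<^sub>p [:2 - 1 / r, -1:])"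
  unfolding R_inv_def by (rule ratfun_subst_Fract) auto

lemma R_inv_add [simp]: "R_inv r (v + w) = R_inv r v + R_inv r w"
  by (cases v rule: ratfun_cases; cases w rule: ratfun_cases)
     (simp add: R_inv_Fract pcompose_nonconst_nonzero pcompose_add pcompose_mult)

lemma R_inv_mult [simp]: "R_inv r (v * w) = R_inv r v * R_inv r w"
  by (cases v rule: ratfun_cases; cases w rule: ratfun_cases)
     (simp add: R_inv_Fract pcompose_nonconst_nonzero pcompose_mult)

lemma R_inv_rconst [simp]: "R_inv r (rconst c) = rconst c"
  by (simp add: rconst_def to_fract_def R_inv_Fract pcompose_1)

lemma R_inv_of_nat [simp]: "R_inv r (of_nat k) = of_nat k"
  using R_inv_rconst[of r "of_nat k"] by (simp add: rconst_of_nat)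

lemma R_inv_0 [simp]: "R_inv r 0 = 0" and R_inv_1 [simp]: "R_inv r 1 = 1"
  using R_inv_of_nat[of r 0] R_inv_of_nat[of r 1] by simp_all

lemma R_inv_numeral [simp]: "R_inv r (numeral k) = numeral k"
  using R_inv_of_nat[of r "numeral k"] by simp

lemma R_inv_uminus [simp]: "R_inv r (- w) = - R_inv r w"
  using R_inv_add[of r "- w" w] by (simp add: eq_neg_iff_add_eq_0)

lemma R_inv_diff [simp]: "R_inv r (v - w) = R_inv r v - R_inv r w"
  using R_inv_add[of r v "- w"] by simp

lemma R_inv_inverse [simp]: "R_inv r (inverse w) = inverse (R_inv r w)"
proof (cases "w = 0")
  case False
  \<comment> \<open>Multiplicativity alone exhibits an inverse of \<open>R_inv r w\<close>, so its
    nonvanishing need not be shown separately.\<close>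
  hence "R_inv r (inverse w) * R_inv r w = 1"
    by (simp flip: R_inv_mult)
  thus ?thesis
    by (metis inverse_unique mult.commute)
qed simp

lemma R_inv_divide [simp]: "R_inv r (v / w) = R_inv r v / R_inv r w"
  by (simp add: divide_inverse)

lemma R_inv_xpoly [simp]: "R_inv r (xpoly b0 b1 b2 k) = xpoly b0 b1 b2 (R_inv r k)"
  by (simp add: xpoly_def)

text \<open>All parameters are constants, fixed by \<open>R_inv\<close>, so only the argument is
  moved.\<close>

lemma R_inv_gamma [simp]:
  "R_inv r (gamma b0 b1 b2 s1 s2 n m r') = gamma b0 b1 b2 s1 s2 (R_inv r n) m r'"
  by (simp add: gamma_def)

lemma R_inv_beta [simp]:
  "R_inv r (beta b0 b1 b2 s1 s2 n r') = beta b0 b1 b2 s1 s2 (R_inv r n) r'"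
  by (simp add: beta_def)

section \<open>Numerators and the polynomial identities between them\<close>

definition gamma_num ::
    "complex \<Rightarrow> complex \<Rightarrow> complex \<Rightarrow> complex \<Rightarrow> complex \<Rightarrow> ratfun \<Rightarrow> ratfun \<Rightarrow> ratfun" where
  "gamma_num b0 b1 b2 s1 s2 i k =
     k * ((k - 1 + i) * xpoly b0 b1 b2 (k - 1) + i * ((k - 1) * rconst s2 + rconst s1))"

text \<open>Numerator and denominator are both divided by \<open>rconst r\<close>. The new numerator
  depends on n and m only through n + 1 - m, so the values at m = 0, 1, 2 become shifts of one
  polynomial.\<close>

lemma gamma_eq:
  assumes "r \<noteq> 0"
  shows "gamma b0 b1 b2 s1 s2 n m r =
    gamma_num b0 b1 b2 s1 s2 (1 / rconst r) (n + 1 - of_nat m) /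
      (2 * n - of_nat m - 1 + 1 / rconst r)"
proof -
  have r: "rconst r \<noteq> 0"
    using assms by simp
  let ?i = "1 / rconst r" and ?k = "n - of_nat m"
  have "(?k + 1) * ((n * rconst r - of_nat m * rconst r + 1) * xpoly b0 b1 b2 ?k
          + ?k * rconst s2 + rconst s1) =
        rconst r * gamma_num b0 b1 b2 s1 s2 ?i (?k + 1)"
    using r by (simp add: gamma_num_def field_simps)
  moreover have "(2 * n - of_nat m - 1) * rconst r + 1 = rconst r * (2 * n - of_nat m - 1 + ?i)"
    using r by (simp add: field_simps)
  moreover have "n + 1 - of_nat m = ?k + 1"
    by simp
  ultimately show ?thesis
    using r by (simp only: gamma_def mult_divide_mult_cancel_left not_False_eq_True)
qed

text \<open>The product formula for \<open>alpha\<close>, with the common factor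
  \<open>gamma\<close> at m = 1 removed, multiplied by 2t(t+1)(t-1); the denominators at m = 0, 1, 2
  are t+1, t, t-1.\<close>

lemma gamma_num_reflect:
  fixes n i :: ratfun
  assumes "t = 2 * n - 2 + i"
  shows "2 * gamma_num b0 b1 b2 s1 s2 i (- n + 2 - i) =
    t * (t - 1) * gamma_num b0 b1 b2 s1 s2 i (n + 1)
    - 2 * (t + 1) * (t - 1) * gamma_num b0 b1 b2 s1 s2 i n
    + t * (t + 1) * gamma_num b0 b1 b2 s1 s2 i (n - 1)
    - 2 * t * (t + 1) * (t - 1) * (xpoly b0 b1 b2 n - xpoly b0 b1 b2 (n - 1))"
  unfolding assms gamma_num_def xpoly_def by algebra

text \<open>The formula for \<open>beta\<close> multiplied by t(t-2): reflection sends the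
  denominators at n and n - 1, namely t and t-2, to their negatives.\<close>

lemma gamma_num_shift_reflect:
  fixes n i :: ratfun
  assumes "t = 2 * n - 2 + i"
  shows "t * (t - 2) * (xpoly b0 b1 b2 (- n + 2 - i) - xpoly b0 b1 b2 (n - 1)) =
    (t - 2) * (gamma_num b0 b1 b2 s1 s2 i (- n + 2 - i) - gamma_num b0 b1 b2 s1 s2 i n)
    + t * (gamma_num b0 b1 b2 s1 s2 i (n - 1) - gamma_num b0 b1 b2 s1 s2 i (- n + 3 - i))"
  unfolding assms gamma_num_def xpoly_def by algebra

text \<open>Undoes the clearing of denominators in \<open>gamma_num_reflect\<close>, with u = t+1
  and v = t-1. It is stated for free variables so that the simplifier does not expand the
  numerators.\<close>

lemma second_difference_quotient:
  fixes q a b c x t u v :: "'a :: field"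
  assumes "(2 :: 'a) \<noteq> 0" "t \<noteq> 0" "u \<noteq> 0" "v \<noteq> 0"
    and "2 * q = t * v * a - 2 * u * v * b + t * u * c - 2 * t * u * v * x"
  shows "1 / 2 * (a / u - 2 * (b / t) + c / v) - x = q / (t * (u * v))"
proof -
  have "2 * (t * (u * v)) * (1 / 2 * (a / u - 2 * (b / t) + c / v) - x) = 2 * q"
    unfolding assms(5) using assms(1-4) by (simp add: right_diff_distrib distrib_left mult_ac)
  hence "2 * ((1 / 2 * (a / u - 2 * (b / t) + c / v) - x) * (t * (u * v))) = 2 * q"
    by (simp only: mult_ac)
  hence "(1 / 2 * (a / u - 2 * (b / t) + c / v) - x) * (t * (u * v)) = q"
    using assms(1) by (simp only: mult_cancel_left simp_thms)
  thus ?thesis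
    using assms(2-4) by (subst nonzero_eq_divide_eq) simp_all
qed

lemma partial_fraction_sum:
  fixes a b x t u :: "'a :: field"
  assumes "t \<noteq> 0" "u \<noteq> 0" "t * u * x = u * a + t * b"
  shows "x = a / t + b / u"
  using assms by (simp add: add_frac_eq nonzero_eq_divide_eq mult_ac)

section \<open>Reflection formulas for \<open>alpha\<close> and \<open>beta\<close>, with N the
  image of the variable\<close>

context
  fixes r :: complex and t N :: ratfun
  assumes r: "r \<noteq> 0"
  defines "t \<equiv> 2 * rvar - 2 + 1 / rconst r"
  defines "N \<equiv> - rvar + 2 - 1 / rconst r"
begin

lemma t_shift_nonzero: "t - 2 \<noteq> 0" "t - 1 \<noteq> 0" "t \<noteq> 0" "t + 1 \<noteq> 0"
proof -
  have t: "t + rconst c \<noteq> 0" for c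
    using two_rvar_add_nonzero[of "c - (2 - 1 / r)"]
    by (simp add: t_def rconst_add rconst_diff rconst_inverse rconst_numeral algebra_simps)
  have zero: "rconst 0 = 0" and one: "rconst 1 = 1"
    using rconst_of_nat[of 0] rconst_of_nat[of 1] by simp_all
  show "t - 2 \<noteq> 0" "t - 1 \<noteq> 0" "t \<noteq> 0" "t + 1 \<noteq> 0"
    \<comment> \<open>Negative shifts are written as differences so that \<open>rconst_diff\<close>
      reduces them to numerals.\<close>
    using t[of "0 - 2"] t[of "0 - 1"] t[of 0] t[of 1]
    unfolding rconst_diff by (simp_all add: rconst_numeral one zero)
qed

lemma alpha_eq_gamma_reflect:
  "alpha b0 b1 b2 s1 s2 rvar r =
     - gamma b0 b1 b2 s1 s2 rvar 1 r * gamma b0 b1 b2 s1 s2 N 1 r / ((t + 1) * (t - 1))"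
proof -
  define P where "P = gamma_num b0 b1 b2 s1 s2 (1 / rconst r)"
  define x where "x = xpoly b0 b1 b2"
  have gP: "gamma b0 b1 b2 s1 s2 n m r = P (n + 1 - of_nat m) / (2 * n - of_nat m - 1 + 1 / rconst r)"
    for n m
    unfolding P_def by (rule gamma_eq[OF r])
  have denoms: "2 * rvar - 1 + 1 / rconst r = t + 1" "2 * rvar - 2 - 1 + 1 / rconst r = t - 1"
    "2 * rvar - 1 - 1 + 1 / rconst r = t" "2 * N - 1 - 1 + 1 / rconst r = - t"
    by (simp_all add: t_def N_def algebra_simps)
  have args: "rvar + 1 - 2 = rvar - 1" "rvar + 1 - 1 = rvar" "N + 1 - 1 = N"
    by simp_all
  have g: "gamma b0 b1 b2 s1 s2 rvar 0 r = P (rvar + 1) / (t + 1)"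
    "gamma b0 b1 b2 s1 s2 rvar 1 r = P rvar / t"
    "gamma b0 b1 b2 s1 s2 rvar 2 r = P (rvar - 1) / (t - 1)"
    "gamma b0 b1 b2 s1 s2 N 1 r = - P N / t"
    unfolding gP of_nat_0 of_nat_1 of_nat_numeral diff_zero denoms args by simp_all
  have "2 * P N = t * (t - 1) * P (rvar + 1) - 2 * (t + 1) * (t - 1) * P rvar
      + t * (t + 1) * P (rvar - 1) - 2 * t * (t + 1) * (t - 1) * (x rvar - x (rvar - 1))"
    unfolding P_def x_def N_def by (rule gamma_num_reflect) (simp add: t_def)
  hence "1 / 2 * (P (rvar + 1) / (t + 1) - 2 * (P rvar / t) + P (rvar - 1) / (t - 1))
      - (x rvar - x (rvar - 1)) = P N / (t * ((t + 1) * (t - 1)))"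
    using t_shift_nonzero two_ratfun_nonzero by (intro second_difference_quotient)
  \<comment> \<open>The factor 1/t on the right and the minus sign of the goal are absorbed by
    \<open>gamma\<close> at N, which is -P(N)/t.\<close>
  thus ?thesis
    unfolding alpha_def g x_def[symmetric] by simp
qed

lemma beta_reflect:
  "beta b0 b1 b2 s1 s2 N r = beta b0 b1 b2 s1 s2 (rvar - 1) r"
proof -
  define P where "P = gamma_num b0 b1 b2 s1 s2 (1 / rconst r)"
  define x where "x = xpoly b0 b1 b2"
  have gP: "gamma b0 b1 b2 s1 s2 n 1 r = P n / (2 * n - 1 - 1 + 1 / rconst r)" for n
    unfolding P_def using gamma_eq[OF r, of b0 b1 b2 s1 s2 n 1] by simp
  have denoms: "2 * (N + 1) - 1 - 1 + 1 / rconst r = - (t - 2)" "2 * N - 1 - 1 + 1 / rconst r = - t"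
    "2 * rvar - 1 - 1 + 1 / rconst r = t" "2 * (rvar - 1) - 1 - 1 + 1 / rconst r = t - 2"
    by (simp_all add: t_def N_def algebra_simps)
  have g: "gamma b0 b1 b2 s1 s2 (N + 1) 1 r = - (P (N + 1) / (t - 2))"
    "gamma b0 b1 b2 s1 s2 N 1 r = - (P N / t)"
    "gamma b0 b1 b2 s1 s2 rvar 1 r = P rvar / t"
    "gamma b0 b1 b2 s1 s2 (rvar - 1) 1 r = P (rvar - 1) / (t - 2)"
    unfolding gP denoms by (simp_all only: minus_divide_right)
  have N1: "N + 1 = - rvar + 3 - 1 / rconst r"
    by (simp add: N_def)
  have "t * (t - 2) * (x N - x (rvar - 1)) = (t - 2) * (P N - P rvar) + t * (P (rvar - 1) - P (N + 1))"
    \<comment> \<open>\<open>N1\<close> is unfolded first, while N is still folded, so that N + 1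
      takes the form 3 - n - i of the identity.\<close>
    unfolding N1 unfolding P_def x_def N_def by (rule gamma_num_shift_reflect) (simp add: t_def)
  hence "x N - x (rvar - 1) = (P N - P rvar) / t + (P (rvar - 1) - P (N + 1)) / (t - 2)"
    using t_shift_nonzero by (intro partial_fraction_sum)
  hence "x N - x (rvar - 1) = P N / t - P rvar / t + (P (rvar - 1) / (t - 2) - P (N + 1) / (t - 2))"
    by (simp only: diff_divide_distrib)
  thus ?thesis
    unfolding beta_def x_def[symmetric] diff_add_cancel g by algebra
qed

end

theorem proposition3p1:
  fixes r b0 b1 b2 s1 s2 :: complex
  assumes "r \<noteq> 0"
    and "\<And>m :: nat. m > 0 \<Longrightarrow> r \<noteq> - 1 / of_nat m"
  shows "R_inv r (alpha b0 b1 b2 s1 s2 rvar r) = alpha b0 b1 b2 s1 s2 rvar r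
    \<and> R_inv r (beta b0 b1 b2 s1 s2 rvar r) = beta b0 b1 b2 s1 s2 (rvar - 1) r
    \<and> alpha b0 b1 b2 s1 s2 rvar r =
        - ((rconst r)\<^sup>2) * gamma b0 b1 b2 s1 s2 rvar 1 r * R_inv r (gamma b0 b1 b2 s1 s2 rvar 1 r)
        / ((2 * rvar * rconst r - rconst r + 1) * (2 * rvar * rconst r - 3 * rconst r + 1))"
    (is "?inv \<and> ?shift \<and> ?prod")
proof (intro conjI)
  let ?i = "1 / rconst r"
  let ?t = "2 * rvar - 2 + ?i"
  let ?g = "gamma b0 b1 b2 s1 s2 rvar 1 r"
  have alpha: "alpha b0 b1 b2 s1 s2 rvar r = - ?g * R_inv r ?g / ((?t + 1) * (?t - 1))"
    using alpha_eq_gamma_reflect[OF assms(1)] by (simp add: R_inv_rvar)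
  \<comment> \<open>Reflection exchanges t+1 and t-1 up to sign, so their product is
    invariant.\<close>
  have "R_inv r ?t = - ?t"
    by (simp add: R_inv_rvar)
  hence "R_inv r ((?t + 1) * (?t - 1)) = (- ?t + 1) * (- ?t - 1)"
    by (simp only: R_inv_mult R_inv_add R_inv_diff R_inv_1)
  also have "\<dots> = (?t + 1) * (?t - 1)"
    by (simp add: algebra_simps)
  finally have denom: "R_inv r ((?t + 1) * (?t - 1)) = (?t + 1) * (?t - 1)" .
  show ?inv
    unfolding alpha R_inv_divide denom
    \<comment> \<open>Since \<open>R_inv\<close> is an involution, it merely swaps the two factors
      \<open>gamma\<close>.\<close>
    by (simp only: R_inv_mult R_inv_uminus R_inv_R_inv) (simp add: mult.commute)
  show ?shift
    using beta_reflect[OF assms(1)] by (simp add: R_inv_rvar)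
  \<comment> \<open>Each stated denominator carries one extra factor r; together they cancel the r
    squared of the numerator.\<close>
  have "2 * rvar * rconst r - rconst r + 1 = rconst r * (?t + 1)"
    "2 * rvar * rconst r - 3 * rconst r + 1 = rconst r * (?t - 1)"
    using assms(1) by (simp_all add: field_simps)
  moreover have "- ((rconst r)\<^sup>2) * ?g * R_inv r ?g / (rconst r * (?t + 1) * (rconst r * (?t - 1)))
      = - ?g * R_inv r ?g / ((?t + 1) * (?t - 1))"
    using assms(1) by (simp add: power2_eq_square)
  ultimately show ?prod
    by (simp only: alpha)
qed

end
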